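(* Let $\mathcal{S}$ and $\mathcal{A}$ be finite non-empty sets, let $R:\mathcal{S}\times\mathcal{A}\to\mathbb{R}$, $\Gamma_{epi}:\mathcal{S}\times\mathcal{A}\to\mathbb{R}$ be fixed functions, let $\kappa\in\mathbb{R}$ and $\lambda_{epi}>0$ be fixed scalars, let $\gamma\in\mathbb{R}$ and let $P(s'|s,a)\in\mathbb{R}$ be given for all $s,s'\in\mathcal{S}$, $a\in\mathcal{A}$. Assume $0\le\gamma<1$; $P(s'|s,a)\ge 0$ for all $s,a,s'$; and $\sum_{s'\in\mathcal{S}}P(s'|s,a)=1$ for all $s,a$. Then the operator $\mathcal{T}^{REV}_\kappa$ on $\mathcal{Q}=\{Q:\mathcal{S}\times\mathcal{A}\to\mathbb{R}\}$ defined by $$\mathcal{T}^{REV}_\kappa Q(s,a)=R(s,a)+\gamma\Bigl(\sum_{s'\in\mathcal{S}}P(s'|s,a)\,\max_{a'\in\mathcal{A}}Q(s',a')-\lambda_{epi}\,\Gamma_{epi}(s,a)-\kappa\Bigr)$$ is a $\gamma$-contraction on $(\mathcal{Q},\|\cdot\|_\infty)$, and it has a unique fixed point $Q^*_{robust}\in\mathcal{Q}$.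
   Context: The norm is $\|Q\|_\infty=\max_{s,a}|Q(s,a)|$. A map $T:\mathcal{Q}\to\mathcal{Q}$ is a $\gamma$-contraction if $\|TQ_1-TQ_2\|_\infty\le\gamma\|Q_1-Q_2\|_\infty$ for all $Q_1,Q_2\in\mathcal{Q}$. The quantities $\kappa$ (aleatoric penalty) and $\Gamma_{epi}$ (epistemic penalty) are fixed, i.e. they do not depend on the function $Q$ to which the operator is applied. *)

theory Defs
  imports "HOL-Analysis.Analysis"
begin

text \<open>
  The finite non-empty state and action sets are types of class finite (every HOL type is
  inhabited), so the space of all Q-functions is the full function type and each maximum
  below ranges over a finite non-empty set.
\<close>

type_synonym ('s, 'a) qfun = "'s \<times> 'a \<Rightarrow> real"

definition qnorm :: "('s::finite, 'a::finite) qfun \<Rightarrow> real" where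
  "qnorm Q = (MAX sa. \<bar>Q sa\<bar>)"

definition is_contraction ::
    "real \<Rightarrow> (('s::finite, 'a::finite) qfun \<Rightarrow> ('s, 'a) qfun) \<Rightarrow> bool" where
  "is_contraction \<gamma> T \<longleftrightarrow>
     (\<forall>Q1 Q2. qnorm (\<lambda>sa. T Q1 sa - T Q2 sa) \<le> \<gamma> * qnorm (\<lambda>sa. Q1 sa - Q2 sa))"

text \<open>
  In the argument order used here, \<open>P s a s'\<close> is the transition probability from \<open>s\<close> to \<open>s'\<close>
  under \<open>a\<close>. The penalties \<open>\<Gamma>\<close> (epistemic) and \<open>\<kappa>\<close> (aleatoric) lie inside the discounted bracket
  but outside the sum.
\<close>

definition T_REV ::
    "('s::finite \<times> 'a::finite \<Rightarrow> real) \<Rightarrow> ('s \<times> 'a \<Rightarrow> real) \<Rightarrow> real \<Rightarrow> real \<Rightarrow> real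
     \<Rightarrow> ('s \<Rightarrow> 'a \<Rightarrow> 's \<Rightarrow> real) \<Rightarrow> ('s, 'a) qfun \<Rightarrow> ('s, 'a) qfun" where
  "T_REV R \<Gamma> lam \<kappa> \<gamma> P Q = (\<lambda>(s, a).
     R (s, a) + \<gamma> * ((\<Sum>s'\<in>UNIV. P s a s' * (MAX a'. Q (s', a'))) - lam * \<Gamma> (s, a) - \<kappa>))"

end

(* The maximum over actions and averaging against P are both non-expansive for the sup norm, so
   the factor \<gamma> makes T_REV a contraction; the penalties cancel in T_REV Q1 - T_REV Q2. For the
   fixed point, the iterates of a contraction converge in each coordinate by comparison with a
   geometric series, and on a finite index set coordinatewise convergence is convergence in norm. *)

theory Submission
  imports Defs
begin

lemma abs_le_qnorm: "\<bar>Q sa\<bar> \<le> qnorm Q"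
  by (simp add: qnorm_def)

lemma qnorm_le_iff: "qnorm Q \<le> c \<longleftrightarrow> (\<forall>sa. \<bar>Q sa\<bar> \<le> c)"
  by (simp add: qnorm_def)

lemma qnorm_nonneg: "0 \<le> qnorm Q"
  using abs_le_qnorm[of Q undefined] by linarith

text \<open>The maximum of finitely many absolute values is at most their sum, and that sum tends to
  0 term by term.\<close>

lemma qnorm_tendsto_0:
  assumes "\<And>sa. (\<lambda>n. Q n sa) \<longlonglongrightarrow> 0"
  shows "(\<lambda>n. qnorm (Q n)) \<longlonglongrightarrow> 0"
proof (rule tendsto_sandwich[OF _ _ tendsto_const])
  have "(\<lambda>n. \<Sum>sa\<in>UNIV. \<bar>Q n sa\<bar>) \<longlonglongrightarrow> (\<Sum>sa\<in>(UNIV :: ('a \<times> 'b) set). \<bar>0\<bar>)"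
    by (intro tendsto_sum tendsto_rabs assms)
  then show "(\<lambda>n. \<Sum>sa\<in>UNIV. \<bar>Q n sa\<bar>) \<longlonglongrightarrow> 0"
    by simp
  show "\<forall>\<^sub>F n in sequentially. qnorm (Q n) \<le> (\<Sum>sa\<in>UNIV. \<bar>Q n sa\<bar>)"
    unfolding qnorm_le_iff
    by (intro always_eventually allI member_le_sum) simp_all
qed (simp add: qnorm_nonneg)

text \<open>Banach's fixed-point theorem for \<open>qnorm\<close>. Completeness is used only for
  real sequences, one coordinate at a time.\<close>

lemma is_contraction_fixed_point:
  assumes T: "is_contraction \<gamma> T" and \<gamma>: "0 \<le> \<gamma>" "\<gamma> < 1"
  shows "\<exists>!Q. T Q = Q"
proof -
  have contr: "qnorm (\<lambda>sa. T Q1 sa - T Q2 sa) \<le> \<gamma> * qnorm (\<lambda>sa. Q1 sa - Q2 sa)" for Q1 Q2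
    using T by (simp add: is_contraction_def)
  \<comment> \<open>The zero function is an arbitrary starting point.\<close>
  define X where "X n = (T ^^ n) (\<lambda>_. 0)" for n
  have X_Suc: "X (Suc n) = T (X n)" for n
    by (simp add: X_def)
  define C where "C = qnorm (\<lambda>sa. X 1 sa - X 0 sa)"
  have step: "qnorm (\<lambda>sa. X (Suc n) sa - X n sa) \<le> \<gamma> ^ n * C" for n
  proof (induction n)
    case (Suc n)
    have "qnorm (\<lambda>sa. X (Suc (Suc n)) sa - X (Suc n) sa) \<le> \<gamma> * qnorm (\<lambda>sa. X (Suc n) sa - X n sa)"
      unfolding X_Suc[of "Suc n"] X_Suc[of n] by (rule contr)
    also have "\<dots> \<le> \<gamma> * (\<gamma> ^ n * C)"
      by (rule mult_left_mono[OF Suc \<gamma>(1)])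
    finally show ?case by simp
  qed (simp add: C_def)
  have "convergent (\<lambda>n. X n sa)" for sa
  proof -
    have "summable (\<lambda>n. \<gamma> ^ n * C)"
      using \<gamma> by (intro summable_mult2 summable_geometric) simp
    then have "summable (\<lambda>n. X (Suc n) sa - X n sa)"
      by (rule summable_comparison_test')
        (use order_trans[OF abs_le_qnorm step] in simp)
    \<comment> \<open>The partial sums of the increments telescope to
      \<open>X n sa - X 0 sa\<close>; adding the constant \<open>X 0 sa\<close> back recovers the
      iterate.\<close>
    then have "convergent (\<lambda>n. (X n sa - X 0 sa) + X 0 sa)"
      by (intro convergent_add convergent_const)
        (simp only: summable_iff_convergent sum_lessThan_telescope[of "\<lambda>n. X n sa"])
    then show ?thesis by simp
  qed
  then obtain L where L: "\<And>sa. (\<lambda>n. X n sa) \<longlonglongrightarrow> L sa"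
    unfolding convergent_def by metis
  \<comment> \<open>The contraction bound speaks of \<open>qnorm\<close> only, so the coordinatewise
    limit must first be turned into a limit in norm.\<close>
  have "(\<lambda>n. qnorm (\<lambda>sa. X n sa - L sa)) \<longlonglongrightarrow> 0"
    by (intro qnorm_tendsto_0 LIM_zero L)
  then have "(\<lambda>n. \<gamma> * qnorm (\<lambda>sa. X n sa - L sa)) \<longlonglongrightarrow> 0"
    by (rule tendsto_mult_right_zero)
  then have "(\<lambda>n. X (Suc n) sa - T L sa) \<longlonglongrightarrow> 0" for sa
    by (rule Lim_null_comparison[rotated])
      (use order_trans[OF abs_le_qnorm contr] in \<open>simp add: X_Suc\<close>)
  then have "(\<lambda>n. X (Suc n) sa) \<longlonglongrightarrow> T L sa" for sa
    by (rule LIM_zero_cancel)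
  \<comment> \<open>In each coordinate the shifted iterates tend both to \<open>T L\<close> and to
    \<open>L\<close>.\<close>
  then have "T L = L"
    using LIMSEQ_unique[OF _ LIMSEQ_Suc[OF L]] by blast
  moreover have "Q = L" if "T Q = Q" for Q
  proof -
    \<comment> \<open>For two fixed points the contraction bound compares their distance with
      \<gamma> times itself.\<close>
    have "(1 - \<gamma>) * qnorm (\<lambda>sa. Q sa - L sa) \<le> 0"
      using contr[of Q L] \<open>T L = L\<close> that by (simp add: algebra_simps)
    then have "qnorm (\<lambda>sa. Q sa - L sa) \<le> 0"
      using \<gamma> by (simp add: mult_le_0_iff)
    then show ?thesis
      by (auto simp: qnorm_le_iff)
  qed
  ultimately show ?thesis by blast
qed

text \<open>Each \<open>f a\<close> is at most \<open>g a + d\<close>, hence at most the maximum of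
  \<open>g\<close> plus \<open>d\<close>; exchanging \<open>f\<close> and \<open>g\<close> gives the
  other half.\<close>

lemma abs_Max_diff_le:
  fixes f g :: "'a::finite \<Rightarrow> real"
  assumes "\<And>a. \<bar>f a - g a\<bar> \<le> d"
  shows "\<bar>(MAX a. f a) - (MAX a. g a)\<bar> \<le> d"
proof -
  have le: "(MAX a. u a) \<le> (MAX a. v a) + d" if "\<And>a. u a \<le> v a + d" for u v :: "'a \<Rightarrow> real"
  proof (intro Max.boundedI)
    fix x assume "x \<in> range u"
    then obtain a where "x = u a" by blast
    moreover have "v a \<le> (MAX a. v a)" by simp
    ultimately show "x \<le> (MAX a. v a) + d"
      using that[of a] by linarith
  qed auto
  have bounds: "f a \<le> g a + d" "g a \<le> f a + d" for a
    using assms[of a] by linarith+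
  show ?thesis
    using le[of f g, OF bounds(1)] le[of g f, OF bounds(2)] by linarith
qed

lemma T_REV_contraction:
  assumes "0 \<le> \<gamma>"
    and P_nonneg: "\<And>s a s'. P s a s' \<ge> 0"
    and P_sum: "\<And>s a. (\<Sum>s'\<in>UNIV. P s a s') = 1"
  shows "is_contraction \<gamma> (T_REV R \<Gamma> lam \<kappa> \<gamma> P)"
  unfolding is_contraction_def qnorm_le_iff
proof (intro allI)
  fix Q1 Q2 :: "('a, 'b) qfun" and sa :: "'a \<times> 'b"
  obtain s a where sa: "sa = (s, a)" by fastforce
  define d where "d = qnorm (\<lambda>sa. Q1 sa - Q2 sa)"
  define m where "m s' = (MAX a'. Q1 (s', a')) - (MAX a'. Q2 (s', a'))" for s'
  have m: "\<bar>m s'\<bar> \<le> d" for s'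
    unfolding m_def d_def
    by (rule abs_Max_diff_le) (rule abs_le_qnorm[of "\<lambda>sa. Q1 sa - Q2 sa"])
  \<comment> \<open>The weights are nonnegative and sum to 1, so averaging \<open>m\<close> keeps
    the bound \<open>d\<close>.\<close>
  have "\<bar>\<Sum>s'\<in>UNIV. P s a s' * m s'\<bar> \<le> (\<Sum>s'\<in>UNIV. P s a s' * d)"
    by (intro order_trans[OF sum_abs] sum_mono) (simp add: abs_mult P_nonneg m mult_left_mono)
  also have "\<dots> = d"
    by (simp flip: sum_distrib_right add: P_sum)
  finally have "\<gamma> * \<bar>\<Sum>s'\<in>UNIV. P s a s' * m s'\<bar> \<le> \<gamma> * d"
    using \<open>0 \<le> \<gamma>\<close> by (rule mult_left_mono)
  \<comment> \<open>Only the averaged difference of the state values \<open>m\<close> survives the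
    subtraction.\<close>
  moreover have "T_REV R \<Gamma> lam \<kappa> \<gamma> P Q1 sa - T_REV R \<Gamma> lam \<kappa> \<gamma> P Q2 sa
      = \<gamma> * (\<Sum>s'\<in>UNIV. P s a s' * m s')"
    by (simp add: T_REV_def sa m_def right_diff_distrib sum_subtractf distrib_left)
  ultimately show "\<bar>T_REV R \<Gamma> lam \<kappa> \<gamma> P Q1 sa - T_REV R \<Gamma> lam \<kappa> \<gamma> P Q2 sa\<bar>
      \<le> \<gamma> * qnorm (\<lambda>sa. Q1 sa - Q2 sa)"
    using \<open>0 \<le> \<gamma>\<close> by (simp add: abs_mult d_def)
qed

theorem theoremE3:
  fixes R \<Gamma> :: "'s::finite \<times> 'a::finite \<Rightarrow> real"
    and \<kappa> lam \<gamma> :: real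
    and P :: "'s \<Rightarrow> 'a \<Rightarrow> 's \<Rightarrow> real"
  assumes lam_pos: "lam > 0"
    and gamma: "0 \<le> \<gamma>" "\<gamma> < 1"
    and P_nonneg: "\<And>s a s'. P s a s' \<ge> 0"
    and P_sum: "\<And>s a. (\<Sum>s'\<in>UNIV. P s a s') = 1"
  shows "is_contraction \<gamma> (T_REV R \<Gamma> lam \<kappa> \<gamma> P) \<and>
         (\<exists>!Q. T_REV R \<Gamma> lam \<kappa> \<gamma> P Q = Q)"
proof
  show contraction: "is_contraction \<gamma> (T_REV R \<Gamma> lam \<kappa> \<gamma> P)"
    by (rule T_REV_contraction[OF gamma(1) P_nonneg P_sum])
  show "\<exists>!Q. T_REV R \<Gamma> lam \<kappa> \<gamma> P Q = Q"
    by (rule is_contraction_fixed_point[OF contraction gamma])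
qed

end
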